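(* Let $n,k\ge 1$. Let $A$ be the set of all $k$-chains of $[n]=\{1,\dots,n\}$, and let $A'$ be the set of the $n$-tuples encoding the elements of $A$. Then there exists a universal cycle for $A'$.
   Context: A $k$-chain of $[n]$ is a sequence of sets $A_1\subseteq A_2\subseteq\cdots\subseteq A_k\subseteq[n]$ (inclusions not necessarily strict). Let $s_i\in\{0,1\}^n$ be the indicator vector of $A_i$. The $k$-chain $C=(A_1,\dots,A_k)$ is encoded by the $n$-tuple $S_C=s_1\oplus\cdots\oplus s_k$, where $\oplus$ is coordinatewise addition of integers; it is regarded as a word of length $n$ over $\{0,\dots,k\}$. A universal cycle for a finite set $A'$ of words of length $n$ over a finite alphabet is a cyclic sequence $c_0c_1\cdots c_{L-1}$ of letters, with $L=|A'|$, such that every word of $A'$ occurs exactly once among the $L$ windows $c_ic_{i+1}\cdots c_{i+n-1}$, $0\le i<L$ (indices modulo $L$). *)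

theory Defs
  imports Main "HOL-Library.Indicator_Function"
begin

(* The list C = [A_1, ..., A_k] stands for the chain; since inclusion is transitive,
   sorted_wrt amounts to inclusion of consecutive members. *)
definition is_chain :: "nat \<Rightarrow> nat \<Rightarrow> nat set list \<Rightarrow> bool" where
  "is_chain n k C \<longleftrightarrow>
     length C = k \<and> sorted_wrt (\<subseteq>) C \<and> (\<forall>A\<in>set C. A \<subseteq> {1..n})"

(* List position i < n carries the coordinate belonging to the element i + 1 of [n]. *)
definition indicator_vector :: "nat \<Rightarrow> nat set \<Rightarrow> nat list" where
  "indicator_vector n A = map (indicator A) [1..<Suc n]"

definition chain_encoding :: "nat \<Rightarrow> nat set list \<Rightarrow> nat list" where
  "chain_encoding n C = map (\<lambda>i. \<Sum>A\<leftarrow>C. indicator_vector n A ! i) [0..<n]"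

definition cyclic_window :: "nat \<Rightarrow> 'a list \<Rightarrow> nat \<Rightarrow> 'a list" where
  "cyclic_window n c i = map (\<lambda>j. c ! ((i + j) mod length c)) [0..<n]"

(* The first two conjuncts are the standing requirements on the alphabet S and on the set W
   of words; together they make W finite, so that card W is its actual cardinality. *)
definition universal_cycle :: "'a set \<Rightarrow> nat \<Rightarrow> 'a list set \<Rightarrow> 'a list \<Rightarrow> bool" where
  "universal_cycle S n W c \<longleftrightarrow>
     finite S \<and> W \<subseteq> {w. set w \<subseteq> S \<and> length w = n} \<and>
     set c \<subseteq> S \<and> length c = card W \<and>
     (\<forall>w\<in>W. \<exists>!i. i < length c \<and> cyclic_window n c i = w)"

end

theory Submission
  imports Defs "Graph_Theory.Euler"
begin

text \<open>
  The encoding of a chain \<open>A\<^sub>1 \<subseteq> \<dots> \<subseteq> A\<^sub>k\<close> records, for each element of \<open>[n]\<close>, how many members of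
  the chain contain it. Since the members containing a given element form a final segment of the
  chain, these numbers determine the chain, and they can be prescribed arbitrarily between \<open>0\<close> and
  \<open>k\<close>: put an element with prescribed number \<open>d\<close> into the last \<open>d\<close> members. Hence the encodings
  are \<^emph>\<open>all\<close> words of length \<open>n\<close> over \<open>{0..k}\<close> (\<open>chain_encodings_eq_words\<close>), and a universal cycle
  for them is a de Bruijn sequence.

  De Bruijn sequences come from Euler's theorem (\<open>de_Bruijn\<close>). In the digraph whose vertices are
  the words of length \<open>n - 1\<close> and whose arcs are the words of length \<open>n\<close>, an arc \<open>w\<close> leading from
  its prefix \<open>butlast w\<close> to its suffix \<open>tl w\<close>, every vertex has as many incoming as outgoing arcs
  (one of each for every letter), and any vertex leads to any other by shifting in the letters of
  the latter. A closed Euler trail is then a cyclic arrangement of all words of length \<open>n\<close> in which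
  each word continues the previous one by one letter, and the first letters of these words spell a
  universal cycle (\<open>universal_cycle_if_overlapping\<close>).
\<close>

section \<open>Encodings of chains\<close>

lemma length_chain_encoding [simp]: "length (chain_encoding n C) = n"
  by (simp add: chain_encoding_def)

lemma chain_encoding_nth:
  assumes "i < n"
  shows "chain_encoding n C ! i = length (filter (\<lambda>A. Suc i \<in> A) C)"
proof -
  have "indicator_vector n A ! i = (if Suc i \<in> A then 1 else 0)" for A
    using assms by (simp add: indicator_vector_def indicator_def del: upt_Suc)
  then have "chain_encoding n C ! i = (\<Sum>A\<leftarrow>C. if Suc i \<in> A then 1 else 0)"
    using assms by (simp add: chain_encoding_def)
  also have "\<dots> = length (filter (\<lambda>A. Suc i \<in> A) C)"
    by (induction C) auto
  finally show ?thesis .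
qed

text \<open>
  A preimage of a word \<open>w\<close> is the chain of its upper level sets, taken at decreasing levels: the
  member at position \<open>j\<close> consists of the elements whose letter exceeds \<open>k - 1 - j\<close>, so that an
  element with letter \<open>d\<close> lies in exactly the last \<open>d\<close> members.
\<close>

lemma chain_encodings_eq_words:
  "chain_encoding n ` {C. is_chain n k C} = {w. set w \<subseteq> {0..k} \<and> length w = n}"
proof (intro equalityI subsetI)
  fix w assume "w \<in> chain_encoding n ` {C. is_chain n k C}"
  then obtain C where C: "length C = k" and w: "w = chain_encoding n C"
    by (auto simp: is_chain_def)
  have "w ! i \<le> k" if "i < n" for i
    using that length_filter_le[of "\<lambda>A. Suc i \<in> A" C] C by (simp add: w chain_encoding_nth)
  then show "w \<in> {w. set w \<subseteq> {0..k} \<and> length w = n}"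
    by (auto simp: w in_set_conv_nth)
next
  fix w :: "nat list" assume "w \<in> {w. set w \<subseteq> {0..k} \<and> length w = n}"
  then have len: "length w = n" and le: "\<And>i. i < n \<Longrightarrow> w ! i \<le> k"
    by (auto dest: nth_mem)
  define level where "level j = {x \<in> {1..n}. k - w ! (x - 1) \<le> j}" for j
  define C where "C = map level [0..<k]"
  have "is_chain n k C"
    by (auto simp: is_chain_def C_def level_def sorted_wrt_iff_nth_less)
  moreover have "chain_encoding n C = w"
  proof (rule nth_equalityI)
    fix i assume "i < length (chain_encoding n C)"
    then have i: "i < n" by simp
    have "chain_encoding n C ! i = card {j. j < k \<and> Suc i \<in> level j}"
      using i by (simp add: chain_encoding_nth C_def length_filter_conv_card cong: conj_cong)
    also have "{j. j < k \<and> Suc i \<in> level j} = {k - w ! i..<k}"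
      using i by (auto simp: level_def)
    finally show "chain_encoding n C ! i = w ! i"
      using le[OF i] by simp
  qed (simp add: len)
  ultimately show "w \<in> chain_encoding n ` {C. is_chain n k C}"
    by blast
qed

section \<open>Universal cycles from overlapping words\<close>

text \<open>
  By induction on \<open>j\<close>, letter \<open>j\<close> of the word at position \<open>i\<close> is the first letter of the word \<open>j\<close>
  positions further on. So the window of the first letters at \<open>i\<close> is the word at \<open>i\<close> itself.
\<close>

lemma universal_cycle_if_overlapping:
  assumes S: "finite S"
    and words: "\<And>w. w \<in> set p \<Longrightarrow> set w \<subseteq> S \<and> length w = n"
    and "n \<ge> 1" and dist: "distinct p"
    and overlap: "\<And>i. i < length p \<Longrightarrow> tl (p ! i) = butlast (p ! (Suc i mod length p))"
  shows "universal_cycle S n (set p) (map hd p)"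
proof -
  let ?L = "length p"
  have len: "length (p ! i) = n" if "i < ?L" for i
    using words that by simp
  have letter: "p ! i ! j = hd (p ! ((i + j) mod ?L))" if "i < ?L" "j < n" for i j
    using that
  proof (induction j arbitrary: i)
    case 0
    then have "p ! i \<noteq> []" using len[of i] by auto
    with 0 show ?case by (simp add: hd_conv_nth)
  next
    case (Suc j)
    let ?i' = "Suc i mod ?L"
    have i': "?i' < ?L" using Suc.prems(1) by (intro mod_less_divisor) auto
    have "p ! i ! Suc j = tl (p ! i) ! j"
      using Suc.prems len[of i] by (simp add: nth_tl)
    also have "\<dots> = butlast (p ! ?i') ! j"
      using overlap Suc.prems(1) by simp
    also have "\<dots> = p ! ?i' ! j"
      using Suc.prems(2) len[OF i'] by (simp add: nth_butlast)
    also have "\<dots> = hd (p ! ((?i' + j) mod ?L))"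
      using Suc.IH[OF i'] Suc.prems(2) by simp
    also have "(?i' + j) mod ?L = (i + Suc j) mod ?L"
      by (simp add: mod_add_left_eq)
    finally show ?case .
  qed
  have window: "cyclic_window n (map hd p) i = p ! i" if "i < ?L" for i
  proof (rule nth_equalityI)
    fix j assume "j < length (cyclic_window n (map hd p) i)"
    then have j: "j < n" by (simp add: cyclic_window_def)
    have "(i + j) mod ?L < ?L" using that by (intro mod_less_divisor) auto
    with j letter[OF that j] show "cyclic_window n (map hd p) i ! j = p ! i ! j"
      by (simp add: cyclic_window_def)
  qed (simp add: cyclic_window_def len[OF that])
  have "\<exists>!i. i < ?L \<and> p ! i = w" if "w \<in> set p" for w
    using dist that by (auto simp: in_set_conv_nth nth_eq_iff_index_eq)
  then have "\<exists>!i. i < ?L \<and> cyclic_window n (map hd p) i = w" if "w \<in> set p" for w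
    using that window by (metis (no_types, lifting))
  moreover have "hd w \<in> S" if "w \<in> set p" for w
    using words[OF that] \<open>n \<ge> 1\<close> by (cases w) auto
  moreover have "set p \<subseteq> {w. set w \<subseteq> S \<and> length w = n}"
    using words by blast
  ultimately show ?thesis
    using S dist unfolding universal_cycle_def by (auto simp: distinct_card)
qed

section \<open>The de Bruijn digraph\<close>

definition de_Bruijn_graph :: "'a set \<Rightarrow> nat \<Rightarrow> ('a list, 'a list) pre_digraph" where
  "de_Bruijn_graph S m =
     \<lparr>verts = {v. set v \<subseteq> S \<and> length v = m}, arcs = {w. set w \<subseteq> S \<and> length w = Suc m},
      tail = butlast, head = tl\<rparr>"

lemma de_Bruijn_graph_simps [simp]:
  "verts (de_Bruijn_graph S m) = {v. set v \<subseteq> S \<and> length v = m}"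
  "arcs (de_Bruijn_graph S m) = {w. set w \<subseteq> S \<and> length w = Suc m}"
  "tail (de_Bruijn_graph S m) = butlast"
  "head (de_Bruijn_graph S m) = tl"
  by (simp_all add: de_Bruijn_graph_def)

lemma fin_digraph_de_Bruijn:
  assumes "finite S"
  shows "fin_digraph (de_Bruijn_graph S m)"
proof -
  have "set (tl w) \<subseteq> set w" "set (butlast w) \<subseteq> set w" for w :: "'a list"
    by (cases w; auto dest: in_set_butlastD)+
  then show ?thesis
    using assms by unfold_locales (simp_all add: finite_lists_length_eq, (blast intro: order_trans)+)
qed

lemma in_degree_de_Bruijn:
  assumes "set v \<subseteq> S" "length v = m"
  shows "in_degree (de_Bruijn_graph S m) v = card S"
proof -
  have "in_arcs (de_Bruijn_graph S m) v = (\<lambda>a. a # v) ` S"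
  proof (rule set_eqI)
    fix e
    show "e \<in> in_arcs (de_Bruijn_graph S m) v \<longleftrightarrow> e \<in> (\<lambda>a. a # v) ` S"
      using assms by (cases e) auto
  qed
  then show ?thesis
    by (simp add: in_degree_def card_image inj_on_def)
qed

lemma out_degree_de_Bruijn:
  assumes "set v \<subseteq> S" "length v = m"
  shows "out_degree (de_Bruijn_graph S m) v = card S"
proof -
  have "out_arcs (de_Bruijn_graph S m) v = (\<lambda>a. v @ [a]) ` S"
  proof (rule set_eqI)
    fix e
    show "e \<in> out_arcs (de_Bruijn_graph S m) v \<longleftrightarrow> e \<in> (\<lambda>a. v @ [a]) ` S"
      using assms by (cases e rule: rev_cases) auto
  qed
  then show ?thesis
    by (simp add: out_degree_def card_image inj_on_def)
qed

text \<open>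
  Shifting in the letters of \<open>x\<close> one after the other moves a window of width \<open>m\<close> along \<open>u @ x\<close>,
  every shift being an arc. If \<open>x\<close> is itself a vertex, the window ends up on \<open>x\<close>; this is why the
  graph is connected.
\<close>

lemma reachable_de_Bruijn_shift:
  assumes "finite S" "set u \<subseteq> S" "length u = m" "set x \<subseteq> S"
  shows "u \<rightarrow>\<^sup>*\<^bsub>de_Bruijn_graph S m\<^esub> drop (length x) (u @ x)"
proof -
  let ?G = "de_Bruijn_graph S m"
  interpret fin_digraph ?G using assms(1) by (rule fin_digraph_de_Bruijn)
  show ?thesis
    using assms(2-)
  proof (induction x arbitrary: u)
    case Nil
    then show ?case by simp
  next
    case (Cons a x)
    let ?w = "u @ [a]"
    have w: "?w \<in> arcs ?G" using Cons.prems by simp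
    then have "u \<rightarrow>\<^bsub>?G\<^esub> tl ?w"
      by (intro dominatesI[of ?w]) (simp_all add: arc_to_ends_def)
    also have "tl ?w \<rightarrow>\<^sup>*\<^bsub>?G\<^esub> drop (length x) (tl ?w @ x)"
      using Cons.IH[of "tl ?w"] head_in_verts[OF w] Cons.prems(3) by simp
    also have "drop (length x) (tl ?w @ x) = drop (length (a # x)) (u @ a # x)"
      by (cases u) simp_all
    finally show ?case .
  qed
qed

lemma connected_de_Bruijn:
  assumes "finite S" "S \<noteq> {}"
  shows "connected (de_Bruijn_graph S m)"
proof -
  let ?G = "de_Bruijn_graph S m"
  interpret fin_digraph ?G using assms(1) by (rule fin_digraph_de_Bruijn)
  have reach: "u \<rightarrow>\<^sup>*\<^bsub>?G\<^esub> v" if "u \<in> verts ?G" "v \<in> verts ?G" for u v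
    using reachable_de_Bruijn_shift[OF assms(1), of u m v] that by simp
  obtain a where "a \<in> S" using assms(2) by blast
  then have "replicate m a \<in> verts ?G" by auto
  then show ?thesis
    unfolding connected_def
    by (intro strongly_connectedI reachable_mk_symmetricI reach)
       (simp_all only: with_proj_simps pverts_mk_symmetric, blast)
qed

section \<open>Existence of universal cycles\<close>

text \<open>
  The recursive predicate \<open>cas\<close> states that consecutive arcs of a walk fit together; its cyclic form
  for closed walks follows from this indexed form.
\<close>

lemma (in pre_digraph) cas_nth:
  assumes "cas u p v" "i < length p"
  shows "tail G (p ! 0) = u"
    and "head G (p ! i) = (if Suc i < length p then tail G (p ! Suc i) else v)"
  using assms
proof (induction p arbitrary: u i)
  case (Cons e p)
  {
    case 1
    then show ?case by simp
  next
    case 2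
    then show ?case
      using Cons.IH[of "head G e"] by (cases i; cases p) auto
  }
qed simp_all

lemma (in pre_digraph) closed_cas_head_eq_tail:
  assumes "cas u p u" "i < length p"
  shows "head G (p ! i) = tail G (p ! (Suc i mod length p))"
proof (cases "Suc i < length p")
  case False
  then have "Suc i = length p" using assms(2) by simp
  then show ?thesis using cas_nth[OF assms] by simp
qed (use cas_nth[OF assms] in simp)

theorem de_Bruijn:
  assumes "finite S" "S \<noteq> {}" "n \<ge> 1"
  shows "\<exists>c. universal_cycle S n {w. set w \<subseteq> S \<and> length w = n} c"
proof -
  obtain m where n: "n = Suc m" using assms(3) by (cases n) auto
  let ?G = "de_Bruijn_graph S m"
  interpret fin_digraph ?G using assms(1) by (rule fin_digraph_de_Bruijn)
  have "in_degree ?G v = out_degree ?G v" if "v \<in> verts ?G" for v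
    using that by (simp add: in_degree_de_Bruijn out_degree_de_Bruijn)
  then obtain u p where "euler_trail u p u"
    using closed_euler1 connected_de_Bruijn[OF assms(1,2)] by blast
  then have cas: "cas u p u" and "distinct p" and p: "set p = {w. set w \<subseteq> S \<and> length w = n}"
    by (simp_all add: euler_trail_def trail_def awalk_def n)
  have "tl (p ! i) = butlast (p ! (Suc i mod length p))" if "i < length p" for i
    using closed_cas_head_eq_tail[OF cas that] by simp
  then have "universal_cycle S n (set p) (map hd p)"
    using assms p \<open>distinct p\<close> by (intro universal_cycle_if_overlapping) auto
  then show ?thesis unfolding p by blast
qed

theorem theorem9:
  fixes n k :: nat
  assumes "n \<ge> 1" and "k \<ge> 1"
  shows "\<exists>c. universal_cycle {0..k} n (chain_encoding n ` {C. is_chain n k C}) c"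
  unfolding chain_encodings_eq_words using assms(1) by (intro de_Bruijn) auto

end
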